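(* With $\Psi^{\beta_0}$ denoting, for $\beta_0\in(1/2,1)$, the equi-kneading curve ending at the diagonal point $(\beta_0,\beta_0)$, and $D_\alpha\Psi^{\beta_0}$ its derivative, $$\lim_{\beta_0\to1-}D_{\alpha}\Psi^{\beta_0}(\beta_0)=-1.$$
   Context: Let $U=\{(\alpha,\beta): 1/2<\beta\le 1,\ 1-\beta<\alpha<\beta\}$. For $(\alpha,\beta)\in U$ the skew tent map $T_{\alpha,\beta}:[0,1]\to[0,1]$ is $T_{\alpha,\beta}(x)=\frac{\beta}{\alpha}x$ for $0\le x\le\alpha$ and $T_{\alpha,\beta}(x)=\frac{\beta}{1-\alpha}(1-x)$ for $\alpha<x\le1$. The extended itinerary of $x\in[0,1]$ is the sequence indexed by $n\ge 0$ whose $n$-th entry is $L$, $C$ or $R$ according to whether $T_{\alpha,\beta}^n(x)<\alpha$, $=\alpha$ or $>\alpha$. The itinerary $\underline{I}_{\alpha,\beta}(x)$ is the extended itinerary if it contains no $C$; otherwise it is the finite string obtained by stopping at (and including) the first $C$. The kneading sequence is $K(\alpha,\beta)=\underline{I}_{\alpha,\beta}(\beta)$. $\mathfrak{M}$ is the set of all kneading sequences $K(1/2,\beta)$, $\beta\in(1/2,1]$. Known facts (Misiurewicz–Visinescu) used to define the curves: for each $\underline{M}\in\mathfrak{M}$ there are numbers $\alpha_1(\underline{M})<\alpha_2(\underline{M})$ and a continuous function $\Psi_{\underline{M}}$ on $(\alpha_1(\underline{M}),\alpha_2(\underline{M}))$ whose graph lies in $U$ and such that for $(\alpha,\beta)\in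 U$ we have $K(\alpha,\beta)=\underline{M}$ if and only if $\beta=\Psi_{\underline{M}}(\alpha)$. If $\underline{M}\neq RL^\infty$, then $\lim_{\alpha\to\alpha_2(\underline{M})-}\Psi_{\underline{M}}(\alpha)=\alpha_2(\underline{M})$, i.e. the curve reaches the diagonal at $(\alpha_2(\underline{M}),\alpha_2(\underline{M}))$, and for every $\beta_0\in(1/2,1)$ there is exactly one $\underline{M}=\underline{M}_{\beta_0}\in\mathfrak{M}\setminus\{RL^\infty\}$ with $\alpha_2(\underline{M})=\beta_0$. For $\beta_0\in(1/2,1)$ put $\Psi^{\beta_0}=\Psi_{\underline{M}_{\beta_0}}$, extended by $\Psi^{\beta_0}(\beta_0)=\beta_0$. $D_\alpha\Psi^{\beta_0}(\beta_0)$ is the derivative of $\Psi^{\beta_0}$ at the endpoint $\beta_0$, i.e. $\lim_{\alpha\to\beta_0-}\frac{\Psi^{\beta_0}(\alpha)-\beta_0}{\alpha-\beta_0}$; the limit assertion is understood to include that this derivative exists for all $\beta_0<1$ sufficiently close to $1$. *)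

theory Defs
  imports "HOL-Analysis.Analysis"
begin

definition param_region :: "(real \<times> real) set" where
  "param_region = {(\<alpha>, \<beta>). 1/2 < \<beta> \<and> \<beta> \<le> 1 \<and> 1 - \<beta> < \<alpha> \<and> \<alpha> < \<beta>}"

(* Only the values on [0,1] matter; for parameters in param_region the map sends [0,1] into itself. *)
definition skew_tent :: "real \<Rightarrow> real \<Rightarrow> real \<Rightarrow> real" where
  "skew_tent \<alpha> \<beta> x = (if x \<le> \<alpha> then \<beta> / \<alpha> * x else \<beta> / (1 - \<alpha>) * (1 - x))"

datatype symbol = L | C | R

datatype itin = Finite_itin "symbol list" | Infinite_itin "nat \<Rightarrow> symbol"

definition extended_itinerary :: "real \<Rightarrow> real \<Rightarrow> real \<Rightarrow> nat \<Rightarrow> symbol" where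
  "extended_itinerary \<alpha> \<beta> x n =
     (let y = (skew_tent \<alpha> \<beta> ^^ n) x in if y < \<alpha> then L else if y = \<alpha> then C else R)"

definition itinerary :: "real \<Rightarrow> real \<Rightarrow> real \<Rightarrow> itin" where
  "itinerary \<alpha> \<beta> x =
     (let e = extended_itinerary \<alpha> \<beta> x in
      if \<forall>n. e n \<noteq> C then Infinite_itin e
      else Finite_itin (map e [0..<Suc (LEAST n. e n = C)]))"

definition kneading :: "real \<Rightarrow> real \<Rightarrow> itin" where
  "kneading \<alpha> \<beta> = itinerary \<alpha> \<beta> \<beta>"

definition tent_kneadings :: "itin set" where
  "tent_kneadings = {kneading (1/2) \<beta> | \<beta>. 1/2 < \<beta> \<and> \<beta> \<le> 1}"

(* The sequence R L L L ..., which is the kneading sequence exactly when \<beta> = 1. *)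
definition RL_inf :: itin where
  "RL_inf = Infinite_itin (\<lambda>n. if n = 0 then R else L)"

(* For a family of curves \<Psi> M over intervals with right endpoints \<alpha>2 M: the curve whose right
   endpoint is \<beta>0, extended to that endpoint by the value \<beta>0. *)
definition curve_ending_at ::
    "(itin \<Rightarrow> real) \<Rightarrow> (itin \<Rightarrow> real \<Rightarrow> real) \<Rightarrow> real \<Rightarrow> real \<Rightarrow> real" where
  "curve_ending_at \<alpha>2 \<Psi> \<beta>0 =
     (\<Psi> (THE M. M \<in> tent_kneadings - {RL_inf} \<and> \<alpha>2 M = \<beta>0)) (\<beta>0 := \<beta>0)"

end

theory Submission
  imports Defs
begin

text \<open>
  Near a diagonal point the dynamics that matters takes place at distance of order
  \<open>\<beta> - \<alpha>\<close> from the turning point. In the coordinate \<open>u = (x - \<alpha>) / (\<beta> - \<alpha>)\<close> the skew tent map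
  becomes \<open>u \<mapsto> 1 + \<kappa> u\<close> for \<open>u \<le> 0\<close> and \<open>u \<mapsto> 1 - \<mu> u\<close> for \<open>u > 0\<close>, where \<open>\<kappa> = \<beta> / \<alpha>\<close> and
  \<open>\<mu> = \<beta> / (1 - \<alpha>)\<close>, and the orbit of \<open>\<beta>\<close> becomes the orbit of \<open>1\<close>. At the diagonal point
  \<open>(\<beta>0, \<beta>0)\<close> this family has a regular limit: \<open>\<kappa> = 1\<close> and \<open>\<mu> = m = \<beta>0 / (1 - \<beta>0)\<close>.

  Along an equi-kneading curve the pattern of left and right branches used by the orbit of \<open>1\<close> is
  fixed (\<open>right_branch_cong_kneading\<close>), so the rescaled orbits \<open>u\<close> converge to an orbit \<open>v\<close> of the
  limit map with the same pattern. Write \<open>P n\<close> for the product of the slopes of the limit map along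
  the first \<open>n\<close> branches. Both \<open>u\<close> and \<open>v\<close> are bounded while \<open>\<bar>P n\<bar>\<close> tends to infinity, hence
  \<open>(u n - v n) / P n\<close> tends to \<open>0\<close>; its increments add up to the exact relation
  \<open>(\<kappa> - 1) * B = (\<mu> - m) * A\<close> (\<open>weighted_sums_relation\<close>), where \<open>A\<close> and \<open>B\<close> are the sums of
  \<open>u k / P (k + 1)\<close> over the visits to the right and to the left branch. Dominated
  convergence carries \<open>A\<close> and \<open>B\<close> to the corresponding sums over \<open>v\<close>, so \<open>(\<mu> - m) / (\<kappa> - 1)\<close> has a limit at the endpoint, and solving for the difference quotient
  of the curve gives the derivative \<open>(A m\<^sup>2 + B) / (B - A m)\<close> (\<open>has_derivative_at_diagonal\<close>).

  When \<open>\<beta>0\<close> approaches \<open>1\<close>, the right slope \<open>m\<close> tends to infinity and only the first passage counts: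
  the start \<open>v 0 = 1\<close> on the right branch gives \<open>A m \<rightarrow> -1\<close>, and the following climb
  \<open>1 - m, 2 - m, \<dots>\<close> along the left branch, whose terms add up to about \<open>- m\<^sup>2 / 2\<close> with weight
  \<open>- 1 / m\<close>, gives \<open>B / m \<rightarrow> 1 / 2\<close>. Each further visit to the right branch costs another factor
  \<open>m\<close> (\<open>right_sum_estimate\<close>, \<open>left_sum_estimate\<close>). The derivative therefore tends to
  \<open>(-1 + 1/2) / (1/2) = -1\<close>.
\<close>

section \<open>Kneading sequences and branch patterns\<close>

definition right_branch :: "real \<Rightarrow> real \<Rightarrow> nat \<Rightarrow> bool" where
  "right_branch \<alpha> \<beta> n \<longleftrightarrow> \<alpha> < (skew_tent \<alpha> \<beta> ^^ n) \<beta>"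

lemma extended_itinerary_eq_R_iff:
  "extended_itinerary \<alpha> \<beta> \<beta> n = R \<longleftrightarrow> right_branch \<alpha> \<beta> n"
  by (auto simp: extended_itinerary_def right_branch_def Let_def)

lemma extended_itinerary_eq_C_iff:
  "extended_itinerary \<alpha> \<beta> x n = C \<longleftrightarrow> (skew_tent \<alpha> \<beta> ^^ n) x = \<alpha>"
  by (auto simp: extended_itinerary_def Let_def)

text \<open>
  The turning point is mapped to \<open>\<beta>\<close>, so an orbit of \<open>\<beta>\<close> that hits it is periodic.
\<close>

lemma right_branch_periodic:
  assumes "\<alpha> \<noteq> 0" "extended_itinerary \<alpha> \<beta> \<beta> N = C"
  shows "right_branch \<alpha> \<beta> (n mod Suc N) = right_branch \<alpha> \<beta> n"
proof -
  have "(skew_tent \<alpha> \<beta> ^^ Suc N) \<beta> = \<beta>"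
    using assms by (simp add: extended_itinerary_eq_C_iff) (simp add: skew_tent_def)
  then show ?thesis
    unfolding right_branch_def by (subst funpow_mod_eq) auto
qed

text \<open>
  A finite kneading sequence also determines the whole branch pattern, because the pattern then
  repeats periodically. Assigning the turning point to the left branch, as the map itself does,
  removes the distinction between finite and infinite kneading sequences from everything below.
\<close>

lemma right_branch_cong_kneading:
  assumes eq: "kneading \<alpha> \<beta> = kneading \<alpha>' \<beta>'" and nz: "\<alpha> \<noteq> 0" "\<alpha>' \<noteq> 0"
  shows "right_branch \<alpha> \<beta> n = right_branch \<alpha>' \<beta>' n"
proof -
  let ?e = "extended_itinerary \<alpha> \<beta> \<beta>" and ?e' = "extended_itinerary \<alpha>' \<beta>' \<beta>'"
  show ?thesis
  proof (cases "\<forall>n. ?e n \<noteq> C")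
    case True
    then have "?e = ?e'"
      using eq by (auto simp: kneading_def itinerary_def Let_def split: if_splits)
    then show ?thesis
      by (simp flip: extended_itinerary_eq_R_iff)
  next
    case False
    define N where "N = (LEAST n. ?e n = C)"
    define N' where "N' = (LEAST n. ?e' n = C)"
    have lists: "map ?e [0..<Suc N] = map ?e' [0..<Suc N']" and ex': "\<not> (\<forall>n. ?e' n \<noteq> C)"
      using eq False unfolding kneading_def itinerary_def Let_def N_def N'_def
      by (auto simp del: upt_Suc split: if_splits)
    have "N = N'"
      using arg_cong[OF lists, of length] by simp
    then have prefix: "?e k = ?e' k" if "k < Suc N" for k
      using lists that by (auto simp del: upt_Suc simp: map_eq_conv)
    have "?e N = C" "?e' N' = C"
      unfolding N_def N'_def using False ex' by (auto intro: LeastI)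
    then have "right_branch \<alpha> \<beta> n = right_branch \<alpha> \<beta> (n mod Suc N)"
      "right_branch \<alpha>' \<beta>' n = right_branch \<alpha>' \<beta>' (n mod Suc N)"
      using right_branch_periodic nz \<open>N = N'\<close> by blast+
    moreover have "?e (n mod Suc N) = ?e' (n mod Suc N)"
      by (rule prefix) simp
    then have "right_branch \<alpha> \<beta> (n mod Suc N) = right_branch \<alpha>' \<beta>' (n mod Suc N)"
      by (simp flip: extended_itinerary_eq_R_iff)
    ultimately show ?thesis by simp
  qed
qed

section \<open>The map on the scale of the distance to the diagonal\<close>

definition rescaled_orbit :: "real \<Rightarrow> real \<Rightarrow> nat \<Rightarrow> real" where
  "rescaled_orbit \<alpha> \<beta> n = ((skew_tent \<alpha> \<beta> ^^ n) \<beta> - \<alpha>) / (\<beta> - \<alpha>)"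

lemma rescaled_orbit_0: "\<alpha> < \<beta> \<Longrightarrow> rescaled_orbit \<alpha> \<beta> 0 = 1"
  by (simp add: rescaled_orbit_def)

lemma rescaled_orbit_pos_iff: "\<alpha> < \<beta> \<Longrightarrow> 0 < rescaled_orbit \<alpha> \<beta> n \<longleftrightarrow> right_branch \<alpha> \<beta> n"
  by (simp add: rescaled_orbit_def right_branch_def zero_less_divide_iff)

lemma rescaled_orbit_Suc:
  assumes "0 < \<alpha>" "\<alpha> < \<beta>" "\<beta> \<le> 1"
  shows "rescaled_orbit \<alpha> \<beta> (Suc n) =
    (if right_branch \<alpha> \<beta> n then 1 - \<beta> / (1 - \<alpha>) * rescaled_orbit \<alpha> \<beta> n
     else 1 + \<beta> / \<alpha> * rescaled_orbit \<alpha> \<beta> n)"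
proof -
  define x where "x = (skew_tent \<alpha> \<beta> ^^ n) \<beta>"
  have nz: "\<beta> - \<alpha> \<noteq> 0" "1 - \<alpha> \<noteq> 0" "\<alpha> \<noteq> 0" using assms by auto
  have Suc_n: "rescaled_orbit \<alpha> \<beta> (Suc n) = (skew_tent \<alpha> \<beta> x - \<alpha>) / (\<beta> - \<alpha>)"
    by (simp add: rescaled_orbit_def x_def)
  show ?thesis
  proof (cases "right_branch \<alpha> \<beta> n")
    case True
    have "skew_tent \<alpha> \<beta> x - \<alpha> = (\<beta> - \<alpha>) - \<beta> / (1 - \<alpha>) * (x - \<alpha>)"
      using True nz by (simp add: skew_tent_def right_branch_def x_def) (simp add: field_simps)
    then have "rescaled_orbit \<alpha> \<beta> (Suc n) = 1 - \<beta> / (1 - \<alpha>) * ((x - \<alpha>) / (\<beta> - \<alpha>))"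
      unfolding Suc_n
      by (simp only: diff_divide_distrib[of "\<beta> - \<alpha>"] divide_self[OF nz(1)] times_divide_eq_right)
    then show ?thesis using True by (simp add: rescaled_orbit_def x_def)
  next
    case False
    have "skew_tent \<alpha> \<beta> x - \<alpha> = (\<beta> - \<alpha>) + \<beta> / \<alpha> * (x - \<alpha>)"
      using False nz by (simp add: skew_tent_def right_branch_def x_def) (simp add: field_simps)
    then have "rescaled_orbit \<alpha> \<beta> (Suc n) = 1 + \<beta> / \<alpha> * ((x - \<alpha>) / (\<beta> - \<alpha>))"
      unfolding Suc_n
      by (simp only: add_divide_distrib[of "\<beta> - \<alpha>"] divide_self[OF nz(1)] times_divide_eq_right)
    then show ?thesis using False by (simp add: rescaled_orbit_def x_def)
  qed
qed

text \<open>
  The interval \<open>[T \<beta>, \<beta>]\<close> is invariant. The lower end is where \<open>\<beta> \<le> 1\<close> enters: it keeps the left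
  branch, of slope \<open>\<beta> / \<alpha> > 1\<close>, from pushing the leftmost point further to the left.
\<close>

lemma rescaled_orbit_bounds:
  assumes "(\<alpha>, \<beta>) \<in> param_region"
  shows "rescaled_orbit \<alpha> \<beta> n \<in> {1 - \<beta> / (1 - \<alpha>)..1}"
proof (induction n)
  case 0
  show ?case using assms by (simp add: rescaled_orbit_0 param_region_def)
next
  case (Suc n)
  define u where "u = rescaled_orbit \<alpha> \<beta> n"
  define \<mu> where "\<mu> = \<beta> / (1 - \<alpha>)"
  have ab: "0 < \<alpha>" "\<alpha> < \<beta>" "\<beta> \<le> 1" "1 - \<beta> < \<alpha>"
    using assms by (auto simp: param_region_def)
  then have \<mu>: "1 < \<mu>" by (simp add: \<mu>_def)
  have u: "1 - \<mu> \<le> u" "u \<le> 1" using Suc by (auto simp: u_def \<mu>_def)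
  show ?case
  proof (cases "right_branch \<alpha> \<beta> n")
    case True
    then have "0 < u" using ab by (simp add: rescaled_orbit_pos_iff u_def)
    then have "\<mu> * u \<le> \<mu> * 1" "0 \<le> \<mu> * u" using u \<mu> by (auto intro!: mult_left_mono)
    then show ?thesis
      using True ab by (simp add: rescaled_orbit_Suc flip: u_def \<mu>_def)
  next
    case False
    then have "u \<le> 0" using ab rescaled_orbit_pos_iff[of \<alpha> \<beta> n] by (simp add: u_def)
    then have "\<beta> / \<alpha> * u \<le> 0" using ab by (simp add: mult_le_0_iff divide_le_0_iff)
    moreover have "\<beta> / \<alpha> * (1 - \<mu>) \<le> \<beta> / \<alpha> * u" using u ab by (intro mult_left_mono) auto
    moreover have "- \<mu> \<le> \<beta> / \<alpha> * (1 - \<mu>)"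
    proof -
      have "\<mu> + \<beta> / \<alpha> * (1 - \<mu>) = \<beta> * (1 - \<beta>) / (\<alpha> * (1 - \<alpha>))"
        using ab by (simp add: \<mu>_def divide_simps) (simp add: algebra_simps)
      also have "\<dots> \<ge> 0" using ab by simp
      finally show ?thesis by simp
    qed
    ultimately show ?thesis
      using False ab by (simp add: rescaled_orbit_Suc flip: u_def \<mu>_def)
  qed
qed

section \<open>The limiting orbit and its weighted sums\<close>

text \<open>
  The slope along the branch pattern \<open>r\<close> for the limit map, with slope \<open>1\<close> on the left and
  \<open>- m\<close> on the right.
\<close>

definition gain :: "(nat \<Rightarrow> bool) \<Rightarrow> real \<Rightarrow> nat \<Rightarrow> real" where
  "gain r m n = (\<Prod>k<n. if r k then - m else 1)"

definition right_term :: "(nat \<Rightarrow> bool) \<Rightarrow> real \<Rightarrow> (nat \<Rightarrow> real) \<Rightarrow> nat \<Rightarrow> real" where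
  "right_term r m x k = (if r k then x k else 0) / gain r m (Suc k)"

definition left_term :: "(nat \<Rightarrow> bool) \<Rightarrow> real \<Rightarrow> (nat \<Rightarrow> real) \<Rightarrow> nat \<Rightarrow> real" where
  "left_term r m x k = (if r k then 0 else x k) / gain r m (Suc k)"

lemma gain_0 [simp]: "gain r m 0 = 1"
  by (simp add: gain_def)

lemma gain_Suc: "gain r m (Suc n) = gain r m n * (if r n then - m else 1)"
  by (simp add: gain_def)

text \<open>
  The orbit of \<open>1\<close> under \<open>u \<mapsto> 1 + u\<close> (left) and \<open>u \<mapsto> 1 - m u\<close> (right). A limit of orbits may hit
  the turning point \<open>0\<close> at a time when the orbits themselves do not, so the pattern is a parameter
  and a right visit is only known to be nonnegative: either branch may be prescribed at \<open>0\<close>, where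
  both give \<open>1\<close>.
\<close>

locale diagonal_orbit =
  fixes r :: "nat \<Rightarrow> bool" and m :: real and v :: "nat \<Rightarrow> real"
  assumes m_ge: "2 \<le> m"
    and v_0: "v 0 = 1"
    and v_Suc: "v (Suc n) = (if r n then 1 - m * v n else 1 + v n)"
    and r_0: "r 0"
    and v_right: "r n \<Longrightarrow> 0 \<le> v n"
    and v_le: "v n \<le> 1"
    and v_ge: "1 - m \<le> v n"
begin

abbreviation "P \<equiv> gain r m"

lemma P_nonzero [simp]: "P n \<noteq> 0"
  using m_ge by (auto simp: gain_def)

lemma abs_P_Suc: "\<bar>P (Suc n)\<bar> = (if r n then m else 1) * \<bar>P n\<bar>"
  using m_ge by (simp add: gain_Suc abs_mult)

lemma abs_v_le: "\<bar>v n\<bar> \<le> m"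
  using v_le[of n] v_ge[of n] m_ge by linarith

text \<open>
  The left branch does not expand, so \<open>1 / \<bar>P k\<bar>\<close> decays only at visits to the right branch. The
  potential \<open>(4 - v k) / \<bar>P k\<bar>\<close> avoids counting the lengths of the passages in between: on the left
  \<open>v\<close> grows by exactly \<open>1\<close>, so the potential drops by \<open>1 / \<bar>P k\<bar>\<close>, and on the right the factor
  \<open>m \<ge> 2\<close> in the denominator outweighs the fall of \<open>v\<close> to \<open>1 - m v\<close>. Any constant
  \<open>c \<ge> 2 m / (m - 1)\<close> would do in place of \<open>4\<close>.
\<close>

lemma inverse_gain_le_potential_drop:
  "1 / \<bar>P (Suc k)\<bar> \<le> (4 - v k) / \<bar>P k\<bar> - (4 - v (Suc k)) / \<bar>P (Suc k)\<bar>"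
proof (cases "r k")
  case True
  define q where "q = \<bar>P (Suc k)\<bar>"
  have q: "0 < q" "q = m * \<bar>P k\<bar>" using True m_ge by (simp_all add: q_def abs_P_Suc)
  have "m * v k \<le> m" using v_le[of k] m_ge by (simp add: mult_left_le)
  then have "1 \<le> m * (4 - v k) - (3 + m * v k)"
    using m_ge by (simp only: right_diff_distrib)
  then have "1 / q \<le> (m * (4 - v k) - (3 + m * v k)) / q"
    using q(1) by (intro divide_right_mono) auto
  also have "\<dots> = m * (4 - v k) / q - (3 + m * v k) / q"
    by (rule diff_divide_distrib)
  also have "m * (4 - v k) / q = (4 - v k) / \<bar>P k\<bar>"
    unfolding q(2) using m_ge by (intro mult_divide_mult_cancel_left) auto
  finally show ?thesis using True by (simp add: v_Suc q_def)
next
  case False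
  have "1 / \<bar>P k\<bar> = ((4 - v k) - (3 - v k)) / \<bar>P k\<bar>" by simp
  also have "\<dots> = (4 - v k) / \<bar>P k\<bar> - (3 - v k) / \<bar>P k\<bar>"
    by (rule diff_divide_distrib)
  finally show ?thesis using False by (simp add: abs_P_Suc v_Suc)
qed

lemma summable_inverse_gain: "summable (\<lambda>k. 1 / \<bar>P (Suc k)\<bar>)"
proof (rule summableI_nonneg_bounded[of _ 3])
  fix n
  define W where "W k = (4 - v k) / \<bar>P k\<bar>" for k
  have "(\<Sum>k<n. 1 / \<bar>P (Suc k)\<bar>) \<le> (\<Sum>k<n. W k - W (Suc k))"
    unfolding W_def by (intro sum_mono inverse_gain_le_potential_drop)
  also have "\<dots> = W 0 - W n" by (rule sum_lessThan_telescope')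
  also have "\<dots> \<le> 3"
    using v_le[of n] by (simp add: W_def v_0)
  finally show "(\<Sum>k<n. 1 / \<bar>P (Suc k)\<bar>) \<le> 3" .
qed simp

lemma bounded_div_gain_tendsto_0:
  assumes "\<And>n. \<bar>x n\<bar> \<le> K"
  shows "(\<lambda>n. x n / P n) \<longlonglongrightarrow> 0"
proof -
  have "(\<lambda>n. 1 / \<bar>P n\<bar>) \<longlonglongrightarrow> 0"
    using summable_LIMSEQ_zero[OF summable_inverse_gain] by (subst (asm) filterlim_sequentially_Suc)
  then have "(\<lambda>n. K * (1 / \<bar>P n\<bar>)) \<longlonglongrightarrow> K * 0" by (intro tendsto_intros)
  then have "(\<lambda>n. K * (1 / \<bar>P n\<bar>)) \<longlonglongrightarrow> 0" by simp
  moreover have "\<forall>\<^sub>F n in sequentially. norm (x n / P n) \<le> K * (1 / \<bar>P n\<bar>)"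
    using assms by (intro always_eventually allI) (simp add: abs_divide divide_right_mono)
  ultimately show ?thesis by (rule Lim_null_comparison[rotated])
qed

lemma summable_bounded_div_gain:
  assumes "\<And>k. \<bar>x k\<bar> \<le> K"
  shows "summable (\<lambda>k. x k / P (Suc k))"
proof (rule summable_comparison_test')
  show "summable (\<lambda>k. K * (1 / \<bar>P (Suc k)\<bar>))"
    by (intro summable_mult summable_inverse_gain)
  show "norm (x k / P (Suc k)) \<le> K * (1 / \<bar>P (Suc k)\<bar>)" if "k \<ge> 0" for k
    using assms[of k] by (simp add: abs_divide divide_right_mono)
qed

lemma summable_terms:
  assumes "\<And>k. \<bar>x k\<bar> \<le> K"
  shows "summable (right_term r m x)" "summable (left_term r m x)"
proof -
  have "0 \<le> K" using assms[of 0] by linarith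
  then have "\<And>k. \<bar>if r k then x k else 0\<bar> \<le> K" "\<And>k. \<bar>if r k then 0 else x k\<bar> \<le> K"
    using assms by auto
  note b = this
  show "summable (right_term r m x)"
    unfolding right_term_def[abs_def] by (rule summable_bounded_div_gain[OF b(1)])
  show "summable (left_term r m x)"
    unfolding left_term_def[abs_def] by (rule summable_bounded_div_gain[OF b(2)])
qed

text \<open>
  The difference \<open>d = u - v\<close> satisfies \<open>d (n + 1) = \<sigma> * d n + e n\<close>, where \<open>\<sigma>\<close> is the slope of the
  limit map and \<open>e n\<close> is \<open>(\<kappa> - 1) * u n\<close> on the left and \<open>- (\<mu> - m) * u n\<close> on the right. Dividing
  by the product of the slopes turns this into a telescoping sum with total \<open>0\<close>.
\<close>

lemma weighted_sums_relation:
  assumes u_0: "u 0 = 1"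
    and u_Suc: "\<And>n. u (Suc n) = (if r n then 1 - \<mu> * u n else 1 + \<kappa> * u n)"
    and u_bound: "\<And>n. \<bar>u n\<bar> \<le> K"
  shows "(\<kappa> - 1) * suminf (left_term r m u) = (\<mu> - m) * suminf (right_term r m u)"
proof -
  define d where "d n = u n - v n" for n
  have "\<bar>d n\<bar> \<le> K + m" for n
    using u_bound[of n] abs_v_le[of n] unfolding d_def by linarith
  then have "(\<lambda>n. d n / P n) \<longlonglongrightarrow> 0" by (rule bounded_div_gain_tendsto_0)
  then have "(\<lambda>n. d (Suc n) / P (Suc n) - d n / P n) sums (0 - d 0 / P 0)"
    by (rule telescope_sums)
  moreover have "d (Suc n) / P (Suc n) - d n / P n =
      (\<kappa> - 1) * left_term r m u n - (\<mu> - m) * right_term r m u n" for n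
  proof -
    have nz: "P n \<noteq> 0" "m \<noteq> 0" using m_ge by auto
    show ?thesis
    proof (cases "r n")
      case True
      have "(\<mu> * u n - m * v n) / (m * P n) - (u n - v n) / P n = (\<mu> - m) * u n / (m * P n)"
        using nz by (simp add: field_simps)
      then show ?thesis
        using True nz by (simp add: d_def u_Suc v_Suc gain_Suc left_term_def right_term_def field_simps)
    next
      case False
      then show ?thesis
        using nz by (simp add: d_def u_Suc v_Suc gain_Suc left_term_def right_term_def field_simps)
    qed
  qed
  ultimately have "(\<lambda>n. (\<kappa> - 1) * left_term r m u n - (\<mu> - m) * right_term r m u n) sums 0"
    by (simp add: d_def u_0 v_0)
  moreover have "(\<lambda>n. (\<kappa> - 1) * left_term r m u n - (\<mu> - m) * right_term r m u n) sums
      ((\<kappa> - 1) * suminf (left_term r m u) - (\<mu> - m) * suminf (right_term r m u))"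
    by (intro sums_diff sums_mult summable_sums summable_terms[OF u_bound])
  ultimately have "(\<kappa> - 1) * suminf (left_term r m u) - (\<mu> - m) * suminf (right_term r m u) = 0"
    by (rule sums_unique2[symmetric])
  then show ?thesis by simp
qed

text \<open>
  Only time \<open>0\<close> is kept. At a visit to the right branch at time \<open>k\<close> the sequence \<open>1 / \<bar>P k\<bar>\<close>
  drops by \<open>(m - 1) / \<bar>P (k + 1)\<bar>\<close>, and it never increases, so the later visits together
  contribute at most \<open>K / (m - 1)\<close> times \<open>1 / \<bar>P 1\<bar> = 1 / m\<close>.
\<close>

lemma sum_right_tail_le:
  assumes x: "\<And>k. r k \<Longrightarrow> \<bar>x k\<bar> \<le> K"
  shows "\<bar>suminf (right_term r m x) + x 0 / m\<bar> \<le> K / (m * (m - 1))"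
proof -
  have K: "0 \<le> K" using x[OF r_0] by linarith
  define y where "y k = (if r k then x k else 0)" for k
  have "\<bar>y k\<bar> \<le> K" for k using x K by (auto simp: y_def)
  then have sm: "summable (right_term r m x)"
    using summable_bounded_div_gain[of y K] by (simp add: y_def right_term_def[abs_def])
  have "(\<lambda>k. 1 / \<bar>P (Suc k)\<bar>) \<longlonglongrightarrow> 0"
    by (rule summable_LIMSEQ_zero[OF summable_inverse_gain])
  then have tele: "(\<lambda>k. 1 / \<bar>P (Suc k)\<bar> - 1 / \<bar>P (Suc (Suc k))\<bar>) sums (1 / \<bar>P (Suc 0)\<bar> - 0)"
    by (rule telescope_sums')
  have "norm (right_term r m x (Suc k)) \<le>
      K / (m - 1) * (1 / \<bar>P (Suc k)\<bar> - 1 / \<bar>P (Suc (Suc k))\<bar>)" for k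
  proof (cases "r (Suc k)")
    case True
    have "1 / \<bar>P (Suc k)\<bar> - 1 / \<bar>P (Suc (Suc k))\<bar> = (m - 1) / \<bar>P (Suc (Suc k))\<bar>"
      using True m_ge by (simp add: abs_P_Suc[of "Suc k"] divide_simps)
    then have "K / (m - 1) * (1 / \<bar>P (Suc k)\<bar> - 1 / \<bar>P (Suc (Suc k))\<bar>) = K / \<bar>P (Suc (Suc k))\<bar>"
      using m_ge by simp
    then show ?thesis
      using True x by (simp add: right_term_def abs_divide divide_right_mono)
  next
    case False
    then show ?thesis by (simp add: right_term_def abs_P_Suc[of "Suc k"])
  qed
  then have "norm (\<Sum>k. right_term r m x (Suc k)) \<le>
      (\<Sum>k. K / (m - 1) * (1 / \<bar>P (Suc k)\<bar> - 1 / \<bar>P (Suc (Suc k))\<bar>))"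
    by (intro norm_suminf_le sums_summable[OF sums_mult[OF tele]])
  also have "\<dots> = K / (m - 1) * (1 / \<bar>P (Suc 0)\<bar>)"
    using sums_unique[OF sums_mult[OF tele, of "K / (m - 1)"]] by simp
  also have "\<dots> = K / (m * (m - 1))"
    using m_ge r_0 by (simp add: abs_P_Suc mult.commute)
  finally have "\<bar>\<Sum>k. right_term r m x (Suc k)\<bar> \<le> K / (m * (m - 1))" by simp
  moreover have "(\<Sum>k. right_term r m x (Suc k)) = suminf (right_term r m x) - right_term r m x 0"
    by (rule suminf_split_head[OF sm])
  moreover have "right_term r m x 0 = - x 0 / m"
    using r_0 by (simp add: right_term_def gain_Suc)
  ultimately show ?thesis by simp
qed

lemma right_sum_estimate: "\<bar>suminf (right_term r m v) + 1 / m\<bar> \<le> 1 / (m * (m - 1))"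
proof -
  have "\<bar>v k\<bar> \<le> 1" if "r k" for k using v_right[OF that] v_le[of k] by simp
  from sum_right_tail_le[of v, OF this] show ?thesis by (simp add: v_0)
qed

text \<open>
  With \<open>g x = x * (x - 1) / 2\<close> a left step satisfies \<open>g (v (k + 1)) - g (v k) = v k\<close>, so the sum over
  each climb along the left branch telescopes and is expressed by the visits to the right branch at
  its two ends. The start contributes nothing since \<open>g 1 = 0\<close>.
\<close>

lemma left_sum_eq_right_sum:
  "suminf (left_term r m v) = - suminf (right_term r m (\<lambda>k. m * v k * ((m + 1) * v k - 2) / 2))"
proof -
  define g where "g x = x * (x - 1) / 2" for x :: real
  define h where "h k = m * v k * ((m + 1) * v k - 2) / 2" for k
  have "\<bar>g (v n)\<bar> \<le> m * (m + 1) / 2" for n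
  proof -
    have "\<bar>v n - 1\<bar> \<le> m + 1" using abs_v_le[of n] by linarith
    then have "\<bar>v n\<bar> * \<bar>v n - 1\<bar> \<le> m * (m + 1)"
      using abs_v_le[of n] m_ge by (intro mult_mono) auto
    then show ?thesis by (simp add: g_def abs_mult)
  qed
  then have "(\<lambda>n. g (v n) / P n) \<longlonglongrightarrow> 0" by (rule bounded_div_gain_tendsto_0)
  then have "(\<lambda>n. g (v (Suc n)) / P (Suc n) - g (v n) / P n) sums (0 - g (v 0) / P 0)"
    by (rule telescope_sums)
  moreover have "g (v (Suc n)) / P (Suc n) - g (v n) / P n = left_term r m v n + right_term r m h n" for n
  proof (cases "r n")
    case True
    have "g (1 - m * v n) = h n - g (v n) * m"
      unfolding g_def h_def by (simp add: field_simps)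
    then have h: "h n = g (1 - m * v n) + g (v n) * m" by simp
    show ?thesis
      using True m_ge
      by (simp add: v_Suc gain_Suc left_term_def right_term_def h add_divide_distrib)
  next
    case False
    then show ?thesis
      using m_ge by (simp add: g_def v_Suc gain_Suc left_term_def right_term_def field_simps)
  qed
  ultimately have "(\<lambda>n. left_term r m v n + right_term r m h n) sums 0"
    by (simp add: g_def v_0)
  then have "(\<lambda>n. (left_term r m v n + right_term r m h n) - left_term r m v n) sums
      (0 - suminf (left_term r m v))"
    by (intro sums_diff summable_sums summable_terms[OF abs_v_le])
  then have "right_term r m h sums (- suminf (left_term r m v))" by simp
  then have "suminf (right_term r m h) = - suminf (left_term r m v)" by (simp add: sums_iff)
  then show ?thesis by (simp add: h_def[abs_def])
qed

lemma left_sum_estimate: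
  "\<bar>suminf (left_term r m v) - (m - 1) / 2\<bar> \<le> (m + 1) / (2 * (m - 1))"
proof -
  define h where "h k = m * v k * ((m + 1) * v k - 2) / 2" for k
  have "\<bar>h k\<bar> \<le> m * (m + 1) / 2" if "r k" for k
  proof -
    have v: "0 \<le> v k" "v k \<le> 1" using v_right[OF that] v_le by auto
    then have "0 \<le> (m + 1) * v k" "(m + 1) * v k \<le> m + 1"
      using m_ge mult_left_mono[of "v k" 1 "m + 1"] by auto
    then have "\<bar>(m + 1) * v k - 2\<bar> \<le> m + 1" using m_ge by linarith
    then have "\<bar>m * v k\<bar> * \<bar>(m + 1) * v k - 2\<bar> \<le> m * (m + 1)"
      using v m_ge by (intro mult_mono) (auto simp: abs_mult mult_left_le)
    then show ?thesis by (simp add: h_def abs_mult)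
  qed
  from sum_right_tail_le[of h, OF this]
  have "\<bar>- suminf (left_term r m v) + h 0 / m\<bar> \<le> m * (m + 1) / 2 / (m * (m - 1))"
    by (simp add: left_sum_eq_right_sum h_def[abs_def])
  moreover have "h 0 / m = (m - 1) / 2" "m * (m + 1) / 2 / (m * (m - 1)) = (m + 1) / (2 * (m - 1))"
    using m_ge by (auto simp: h_def v_0)
  ultimately show ?thesis by (simp add: abs_minus_commute)
qed

text \<open>
  The weights belong to the limit map and do not depend on the varying orbit, which makes a multiple
  of \<open>1 / \<bar>P (k + 1)\<bar>\<close> a common dominating sequence.
\<close>

lemma terms_tendsto:
  assumes F: "F \<noteq> bot"
    and lim: "\<And>k. ((\<lambda>a. u a k) \<longlongrightarrow> v k) F"
    and bound: "\<forall>\<^sub>F a in F. \<forall>k. \<bar>u a k\<bar> \<le> K"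
  shows "((\<lambda>a. suminf (right_term r m (u a))) \<longlongrightarrow> suminf (right_term r m v)) F"
    and "((\<lambda>a. suminf (left_term r m (u a))) \<longlongrightarrow> suminf (left_term r m v)) F"
proof -
  have sm: "summable (\<lambda>k. K * (1 / \<bar>P (Suc k)\<bar>))"
    by (intro summable_mult summable_inverse_gain)
  obtain a where "\<forall>k. \<bar>u a k\<bar> \<le> K" using eventually_happens[OF bound] F by blast
  then have K: "0 \<le> K" by (meson abs_ge_zero order_trans)
  have ev: "\<forall>\<^sub>F (k, a) in at_top \<times>\<^sub>F F. \<forall>k. \<bar>u a k\<bar> \<le> K"
    using eventually_prodI[OF eventually_True bound] by (simp add: case_prod_unfold)
  have "\<forall>\<^sub>F (k, a) in at_top \<times>\<^sub>F F. norm (right_term r m (u a) k) \<le> K * (1 / \<bar>P (Suc k)\<bar>)"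
    using ev by (rule eventually_mono)
      (auto simp: right_term_def abs_divide divide_right_mono K)
  moreover have "((\<lambda>a. right_term r m (u a) k) \<longlongrightarrow> right_term r m v k) F" for k
    unfolding right_term_def using lim by (cases "r k") (auto intro!: tendsto_intros)
  ultimately show "((\<lambda>a. suminf (right_term r m (u a))) \<longlongrightarrow> suminf (right_term r m v)) F"
    using tannerys_theorem[of "\<lambda>k a. right_term r m (u a) k" "right_term r m v" F, OF _ _ sm F]
    by blast
  have "\<forall>\<^sub>F (k, a) in at_top \<times>\<^sub>F F. norm (left_term r m (u a) k) \<le> K * (1 / \<bar>P (Suc k)\<bar>)"
    using ev by (rule eventually_mono)
      (auto simp: left_term_def abs_divide divide_right_mono K)
  moreover have "((\<lambda>a. left_term r m (u a) k) \<longlongrightarrow> left_term r m v k) F" for k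
    unfolding left_term_def using lim by (cases "r k") (auto intro!: tendsto_intros)
  ultimately show "((\<lambda>a. suminf (left_term r m (u a))) \<longlongrightarrow> suminf (left_term r m v)) F"
    using tannerys_theorem[of "\<lambda>k a. left_term r m (u a) k" "left_term r m v" F, OF _ _ sm F]
    by blast
qed

end

section \<open>The slope of an equi-kneading curve at the diagonal\<close>

primrec diagonal_iterate :: "(nat \<Rightarrow> bool) \<Rightarrow> real \<Rightarrow> nat \<Rightarrow> real" where
  "diagonal_iterate r m 0 = 1"
| "diagonal_iterate r m (Suc n) =
     (if r n then 1 - m * diagonal_iterate r m n else 1 + diagonal_iterate r m n)"

text \<open>
  A curve with constant branch pattern that ends at the diagonal point \<open>(\<beta>0, \<beta>0)\<close>. The bound \<open>3/4\<close>
  makes the right slope of the limit map at least \<open>3\<close>, which is what the crude estimates of the sums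
  need to fix their signs.
\<close>

locale curve_to_diagonal =
  fixes r :: "nat \<Rightarrow> bool" and \<psi> :: "real \<Rightarrow> real" and \<beta>0 :: real
  assumes \<beta>0: "3/4 \<le> \<beta>0" "\<beta>0 < 1"
    and region: "\<forall>\<^sub>F a in at_left \<beta>0. (a, \<psi> a) \<in> param_region"
    and pattern: "\<forall>\<^sub>F a in at_left \<beta>0. \<forall>n. right_branch a (\<psi> a) n = r n"
    and lim: "(\<psi> \<longlongrightarrow> \<beta>0) (at_left \<beta>0)"
begin

definition "m = \<beta>0 / (1 - \<beta>0)"

definition "v = diagonal_iterate r m"

abbreviation "u a \<equiv> rescaled_orbit a (\<psi> a)"

lemma right_slope_tendsto: "((\<lambda>a. \<psi> a / (1 - a)) \<longlongrightarrow> m) (at_left \<beta>0)"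
  unfolding m_def using \<beta>0 by (auto intro!: tendsto_intros lim)

lemma left_slope_tendsto: "((\<lambda>a. \<psi> a / a) \<longlongrightarrow> 1) (at_left \<beta>0)"
proof -
  have "((\<lambda>a. \<psi> a / a) \<longlongrightarrow> \<beta>0 / \<beta>0) (at_left \<beta>0)"
    by (rule tendsto_divide[OF lim tendsto_ident_at]) (use \<beta>0 in simp)
  then show ?thesis using \<beta>0 by simp
qed

lemma rescaled_orbit_recursion:
  "\<forall>\<^sub>F a in at_left \<beta>0. u a 0 = 1 \<and>
     (\<forall>n. u a (Suc n) = (if r n then 1 - \<psi> a / (1 - a) * u a n else 1 + \<psi> a / a * u a n))"
  using region pattern
  by eventually_elim (auto simp: param_region_def rescaled_orbit_0 rescaled_orbit_Suc)

lemma rescaled_orbit_tendsto: "((\<lambda>a. u a n) \<longlongrightarrow> v n) (at_left \<beta>0)"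
proof (induction n)
  case 0
  have "\<forall>\<^sub>F a in at_left \<beta>0. 1 = u a 0"
    using rescaled_orbit_recursion by eventually_elim auto
  then show ?case
    by (rule Lim_transform_eventually[rotated]) (simp add: v_def)
next
  case (Suc n)
  let ?w = "\<lambda>a. if r n then 1 - \<psi> a / (1 - a) * u a n else 1 + \<psi> a / a * u a n"
  have "\<forall>\<^sub>F a in at_left \<beta>0. ?w a = u a (Suc n)"
    using rescaled_orbit_recursion by eventually_elim auto
  moreover have "(?w \<longlongrightarrow> (if r n then 1 - m * v n else 1 + 1 * v n)) (at_left \<beta>0)"
    using tendsto_mult[OF right_slope_tendsto Suc] tendsto_mult[OF left_slope_tendsto Suc]
    by (cases "r n") (simp_all only: if_True if_False tendsto_add tendsto_diff tendsto_const)
  ultimately have "((\<lambda>a. u a (Suc n)) \<longlongrightarrow> (if r n then 1 - m * v n else 1 + 1 * v n)) (at_left \<beta>0)"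
    by (rule Lim_transform_eventually[rotated])
  then show ?case by (simp add: v_def split: if_splits)
qed

lemma rescaled_orbit_signs:
  "\<forall>\<^sub>F a in at_left \<beta>0. \<forall>n. 0 < u a n \<longleftrightarrow> r n"
  using region pattern
  by eventually_elim (auto simp: param_region_def rescaled_orbit_pos_iff)

lemma rescaled_orbit_range:
  "\<forall>\<^sub>F a in at_left \<beta>0. \<forall>n. u a n \<in> {1 - \<psi> a / (1 - a)..1}"
  using region by eventually_elim (use rescaled_orbit_bounds in blast)

lemma rescaled_orbit_bounded: "\<forall>\<^sub>F a in at_left \<beta>0. \<forall>n. \<bar>u a n\<bar> \<le> m + 1"
proof -
  have "\<forall>\<^sub>F a in at_left \<beta>0. 0 \<le> m" using \<beta>0 by (simp add: m_def)
  moreover have "\<forall>\<^sub>F a in at_left \<beta>0. \<psi> a / (1 - a) < m + 1"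
    by (rule order_tendstoD[OF right_slope_tendsto]) simp
  ultimately show ?thesis
    using rescaled_orbit_range
  proof eventually_elim
    case (elim a)
    show ?case
    proof
      fix n
      have "1 - \<psi> a / (1 - a) \<le> u a n" "u a n \<le> 1" using elim(3) by auto
      then show "\<bar>u a n\<bar> \<le> m + 1" using elim by linarith
    qed
  qed
qed

sublocale diagonal_orbit r m v
proof
  show "2 \<le> m" using \<beta>0 by (simp add: m_def field_simps)
  show "v 0 = 1" by (simp add: v_def)
  show "v (Suc n) = (if r n then 1 - m * v n else 1 + v n)" for n by (simp add: v_def)
  show "r 0"
    using eventually_happens[OF eventually_conj[OF rescaled_orbit_signs rescaled_orbit_recursion]]
    by force
  show "0 \<le> v n" if "r n" for n
    by (rule tendsto_lowerbound[OF rescaled_orbit_tendsto])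
      (rule eventually_mono[OF rescaled_orbit_signs], use that in \<open>auto intro: less_imp_le\<close>)
  show "v n \<le> 1" for n
    by (rule tendsto_upperbound[OF rescaled_orbit_tendsto])
      (rule eventually_mono[OF rescaled_orbit_range], auto)
  show "1 - m \<le> v n" for n
  proof (rule tendsto_le[OF _ rescaled_orbit_tendsto])
    show "((\<lambda>a. 1 - \<psi> a / (1 - a)) \<longlongrightarrow> 1 - m) (at_left \<beta>0)"
      by (intro tendsto_intros right_slope_tendsto)
    show "\<forall>\<^sub>F a in at_left \<beta>0. 1 - \<psi> a / (1 - a) \<le> u a n"
      by (rule eventually_mono[OF rescaled_orbit_range]) auto
  qed simp
qed

definition "right_sum = suminf (right_term r m v)"

definition "left_sum = suminf (left_term r m v)"

lemma m_ge_3: "3 \<le> m"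
  using \<beta>0 by (simp add: m_def field_simps)

lemma right_sum_neg: "right_sum < 0"
proof -
  have "m < m * (m - 1)" using m_ge_3 by simp
  then have "1 / (m * (m - 1)) < 1 / m"
    using m_ge_3 by (intro divide_strict_left_mono) auto
  moreover have "\<bar>right_sum + 1 / m\<bar> \<le> 1 / (m * (m - 1))"
    unfolding right_sum_def by (rule right_sum_estimate)
  ultimately show ?thesis by linarith
qed

lemma left_sum_nonneg: "0 \<le> left_sum"
proof -
  have "0 \<le> m * (m - 3)" using m_ge_3 by simp
  then have "m + 1 \<le> (m - 1) * (m - 1)" by (simp add: algebra_simps)
  then have "(m + 1) / (m - 1) \<le> m - 1" using m_ge_3 by (simp add: pos_divide_le_eq)
  then have "(m + 1) / (2 * (m - 1)) \<le> (m - 1) / 2"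
    using divide_right_mono[of "(m + 1) / (m - 1)" "m - 1" 2] by (simp add: mult.commute)
  moreover have "\<bar>left_sum - (m - 1) / 2\<bar> \<le> (m + 1) / (2 * (m - 1))"
    unfolding left_sum_def by (rule left_sum_estimate)
  ultimately show ?thesis by linarith
qed

lemma weighted_sums_tendsto:
  "((\<lambda>a. suminf (right_term r m (u a))) \<longlongrightarrow> right_sum) (at_left \<beta>0)"
  "((\<lambda>a. suminf (left_term r m (u a))) \<longlongrightarrow> left_sum) (at_left \<beta>0)"
  unfolding right_sum_def left_sum_def
  by (rule terms_tendsto[OF _ rescaled_orbit_tendsto rescaled_orbit_bounded]; simp)+

lemma weighted_sums_curve_relation:
  "\<forall>\<^sub>F a in at_left \<beta>0.
     (\<psi> a / a - 1) * suminf (left_term r m (u a)) =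
     (\<psi> a / (1 - a) - m) * suminf (right_term r m (u a))"
  using rescaled_orbit_recursion rescaled_orbit_bounded
  by eventually_elim (rule weighted_sums_relation, auto)

text \<open>
  The relation between the sums is linear in the increments of \<open>\<kappa>\<close> and \<open>\<mu>\<close>, and the numerators of
  these are linear in \<open>b - \<beta>0\<close> and \<open>a - \<beta>0\<close>; so it can be solved for the difference quotient without
  any approximation.
\<close>

lemma difference_quotient_eq:
  fixes a b A B :: real
  assumes a: "0 < a" "a < \<beta>0"
    and rel: "(b / a - 1) * B = (b / (1 - a) - m) * A"
    and nz: "B / a - A / (1 - a) \<noteq> 0"
  shows "(b - \<beta>0) / (a - \<beta>0) =
    (B / a + \<beta>0 * A / ((1 - a) * (1 - \<beta>0))) / (B / a - A / (1 - a))"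
proof -
  define x y where "x = b - \<beta>0" and "y = a - \<beta>0"
  have "b / a - 1 = (x - y) / a"
    using a by (simp add: x_def y_def diff_divide_distrib)
  moreover have "b / (1 - a) - m = x / (1 - a) + \<beta>0 * y / ((1 - a) * (1 - \<beta>0))"
    using a \<beta>0 unfolding m_def x_def y_def by (simp add: divide_simps) (simp add: algebra_simps)
  ultimately have "(x - y) / a * B = (x / (1 - a) + \<beta>0 * y / ((1 - a) * (1 - \<beta>0))) * A"
    using rel by simp
  then have "x * (B / a - A / (1 - a)) = y * (B / a + \<beta>0 * A / ((1 - a) * (1 - \<beta>0)))"
    by (simp add: algebra_simps diff_divide_distrib add_divide_distrib)
  moreover have "y \<noteq> 0" using a by (simp add: y_def)
  ultimately show ?thesis
    using nz unfolding x_def[symmetric] y_def[symmetric] by (simp add: frac_eq_eq mult.commute)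
qed

lemma has_derivative_at_diagonal:
  "(\<psi>(\<beta>0 := \<beta>0) has_real_derivative
     (right_sum * m\<^sup>2 + left_sum) / (left_sum - right_sum * m)) (at_left \<beta>0)"
proof -
  define A where "A a = suminf (right_term r m (u a))" for a
  define B where "B a = suminf (left_term r m (u a))" for a
  let ?den = "\<lambda>a. B a / a - A a / (1 - a)"
  let ?num = "\<lambda>a. B a / a + \<beta>0 * A a / ((1 - a) * (1 - \<beta>0))"
  have A: "(A \<longlongrightarrow> right_sum) (at_left \<beta>0)" and B: "(B \<longlongrightarrow> left_sum) (at_left \<beta>0)"
    unfolding A_def B_def by (fact weighted_sums_tendsto)+
  have den: "(?den \<longlongrightarrow> left_sum / \<beta>0 - right_sum / (1 - \<beta>0)) (at_left \<beta>0)"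
    using \<beta>0 by (intro tendsto_intros A B) auto
  have num: "(?num \<longlongrightarrow> left_sum / \<beta>0 + \<beta>0 * right_sum / ((1 - \<beta>0) * (1 - \<beta>0))) (at_left \<beta>0)"
    using \<beta>0 by (intro tendsto_intros A B) auto
  \<comment> \<open>The two sums have opposite signs, so the denominator cannot degenerate in the limit.\<close>
  have "right_sum / (1 - \<beta>0) < 0" "0 \<le> left_sum / \<beta>0"
    using right_sum_neg left_sum_nonneg \<beta>0 by (auto simp: divide_less_0_iff)
  then have pos: "0 < left_sum / \<beta>0 - right_sum / (1 - \<beta>0)" by linarith
  have "((\<lambda>a. ?num a / ?den a) \<longlongrightarrow>
      (left_sum / \<beta>0 + \<beta>0 * right_sum / ((1 - \<beta>0) * (1 - \<beta>0))) /
      (left_sum / \<beta>0 - right_sum / (1 - \<beta>0))) (at_left \<beta>0)"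
    using pos by (intro tendsto_divide num den) auto
  also have "left_sum / \<beta>0 + \<beta>0 * right_sum / ((1 - \<beta>0) * (1 - \<beta>0)) =
      (right_sum * m\<^sup>2 + left_sum) / \<beta>0"
    using \<beta>0 by (simp add: m_def power2_eq_square add_divide_distrib)
  also have "left_sum / \<beta>0 - right_sum / (1 - \<beta>0) = (left_sum - right_sum * m) / \<beta>0"
    using \<beta>0 by (simp add: m_def diff_divide_distrib)
  also have "(right_sum * m\<^sup>2 + left_sum) / \<beta>0 / ((left_sum - right_sum * m) / \<beta>0) =
      (right_sum * m\<^sup>2 + left_sum) / (left_sum - right_sum * m)"
    using \<beta>0 by simp
  finally have lim: "((\<lambda>a. ?num a / ?den a) \<longlongrightarrow>
      (right_sum * m\<^sup>2 + left_sum) / (left_sum - right_sum * m)) (at_left \<beta>0)" .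
  have "\<forall>\<^sub>F a in at_left \<beta>0. 0 < ?den a"
    by (rule order_tendstoD(1)[OF den pos])
  moreover have "\<forall>\<^sub>F a in at_left \<beta>0. 0 < a \<and> a < \<beta>0"
    using eventually_at_left_real[of 0 \<beta>0] \<beta>0 by (auto elim: eventually_mono)
  ultimately have "\<forall>\<^sub>F a in at_left \<beta>0. ?num a / ?den a =
      ((\<psi>(\<beta>0 := \<beta>0)) a - (\<psi>(\<beta>0 := \<beta>0)) \<beta>0) / (a - \<beta>0)"
    using weighted_sums_curve_relation
  proof eventually_elim
    case (elim a)
    have "(\<psi> a - \<beta>0) / (a - \<beta>0) = ?num a / ?den a"
      using elim by (intro difference_quotient_eq) (auto simp: A_def B_def)
    then show ?case using elim by simp
  qed
  from Lim_transform_eventually[OF lim this] show ?thesis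
    unfolding has_field_derivative_iff .
qed

text \<open>
  In terms of \<open>i = 1 / m\<close>, which tends to \<open>0\<close> as \<open>\<beta>0\<close> tends to \<open>1\<close>, both the error bounds and the
  derivative are continuous expressions.
\<close>

lemma normalized_sum_estimates:
  defines "i \<equiv> (1 - \<beta>0) / \<beta>0"
  shows "\<bar>right_sum * m - (- 1)\<bar> \<le> i / (1 - i)"
    and "\<bar>left_sum / m - (1 - i) / 2\<bar> \<le> i * (1 + i) / (2 * (1 - i))"
    and "(right_sum * m\<^sup>2 + left_sum) / (left_sum - right_sum * m) =
      (right_sum * m + left_sum / m) / (left_sum / m - right_sum * m * i)"
proof -
  have i: "i = 1 / m" by (simp add: i_def m_def)
  have m: "0 < m" "1 < m" using m_ge_3 by auto
  have "\<bar>right_sum + 1 / m\<bar> * m \<le> 1 / (m * (m - 1)) * m"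
    using right_sum_estimate m unfolding right_sum_def by (intro mult_right_mono) auto
  also have "\<dots> = i / (1 - i)" using m by (simp add: i field_simps)
  also have "\<bar>right_sum + 1 / m\<bar> * m = \<bar>(right_sum + 1 / m) * m\<bar>"
    using m by (simp add: abs_mult)
  also have "(right_sum + 1 / m) * m = right_sum * m - (- 1)"
    using m by (simp add: algebra_simps)
  finally show "\<bar>right_sum * m - (- 1)\<bar> \<le> i / (1 - i)" .
  have "\<bar>left_sum - (m - 1) / 2\<bar> / m \<le> (m + 1) / (2 * (m - 1)) / m"
    using left_sum_estimate m unfolding left_sum_def by (intro divide_right_mono) auto
  also have "\<dots> = i * (1 + i) / (2 * (1 - i))" using m by (simp add: i divide_simps)
  also have "\<bar>left_sum - (m - 1) / 2\<bar> / m = \<bar>(left_sum - (m - 1) / 2) / m\<bar>"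
    using m by (simp add: abs_divide)
  also have "(left_sum - (m - 1) / 2) / m = left_sum / m - (1 - i) / 2"
    using m by (simp add: i diff_divide_distrib)
  finally show "\<bar>left_sum / m - (1 - i) / 2\<bar> \<le> i * (1 + i) / (2 * (1 - i))" .
  have "right_sum * m + left_sum / m = (right_sum * m\<^sup>2 + left_sum) / m"
    using m by (simp add: power2_eq_square add_divide_distrib)
  moreover have "left_sum / m - right_sum * m * i = (left_sum - right_sum * m) / m"
    using m by (simp add: i diff_divide_distrib)
  ultimately show "(right_sum * m\<^sup>2 + left_sum) / (left_sum - right_sum * m) =
      (right_sum * m + left_sum / m) / (left_sum / m - right_sum * m * i)"
    using m by simp
qed

end

text \<open>
  Here \<open>p\<close> and \<open>q\<close> are the normalized sums \<open>A m\<close> and \<open>B / m\<close>; the branch pattern, which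
  is different for each \<open>\<beta>0\<close>, is hidden in them before \<open>\<beta>0\<close> varies.
\<close>

lemma endpoint_derivative_exists:
  assumes "curve_to_diagonal r \<psi> \<beta>0"
  defines "i \<equiv> (1 - \<beta>0) / \<beta>0"
  shows "\<exists>p q. \<bar>p - (- 1)\<bar> \<le> i / (1 - i) \<and> \<bar>q - (1 - i) / 2\<bar> \<le> i * (1 + i) / (2 * (1 - i)) \<and>
    (\<psi>(\<beta>0 := \<beta>0) has_real_derivative (p + q) / (q - p * i)) (at_left \<beta>0)"
proof -
  interpret curve_to_diagonal r \<psi> \<beta>0 by fact
  show ?thesis
    using normalized_sum_estimates has_derivative_at_diagonal unfolding i_def by metis
qed

theorem theorem11:
  fixes \<alpha>1 \<alpha>2 :: "itin \<Rightarrow> real" and \<Psi> :: "itin \<Rightarrow> real \<Rightarrow> real"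
  assumes interval: "\<And>M. M \<in> tent_kneadings \<Longrightarrow> \<alpha>1 M < \<alpha>2 M"
    and continuous: "\<And>M. M \<in> tent_kneadings \<Longrightarrow> continuous_on {\<alpha>1 M<..<\<alpha>2 M} (\<Psi> M)"
    and graph_in_region: "\<And>M \<alpha>. M \<in> tent_kneadings \<Longrightarrow> \<alpha> \<in> {\<alpha>1 M<..<\<alpha>2 M} \<Longrightarrow>
          (\<alpha>, \<Psi> M \<alpha>) \<in> param_region"
    and level_set: "\<And>M \<alpha> \<beta>. M \<in> tent_kneadings \<Longrightarrow> (\<alpha>, \<beta>) \<in> param_region \<Longrightarrow>
          kneading \<alpha> \<beta> = M \<longleftrightarrow> \<alpha> \<in> {\<alpha>1 M<..<\<alpha>2 M} \<and> \<beta> = \<Psi> M \<alpha>"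
    and reaches_diagonal: "\<And>M. M \<in> tent_kneadings - {RL_inf} \<Longrightarrow>
          (\<Psi> M \<longlongrightarrow> \<alpha>2 M) (at_left (\<alpha>2 M))"
    and unique_endpoint: "\<And>\<beta>0. \<beta>0 \<in> {1/2<..<1} \<Longrightarrow>
          \<exists>!M. M \<in> tent_kneadings - {RL_inf} \<and> \<alpha>2 M = \<beta>0"
  shows "\<exists>D :: real \<Rightarrow> real.
      (\<forall>\<^sub>F \<beta>0 in at_left 1.
         (curve_ending_at \<alpha>2 \<Psi> \<beta>0 has_real_derivative D \<beta>0) (at_left \<beta>0)) \<and>
      (D \<longlongrightarrow> -1) (at_left 1)"
proof -
  define i where "i \<beta>0 = (1 - \<beta>0) / \<beta>0" for \<beta>0 :: real
  define good where "good \<beta>0 p q \<longleftrightarrow>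
      \<bar>p - (- 1)\<bar> \<le> i \<beta>0 / (1 - i \<beta>0) \<and>
      \<bar>q - (1 - i \<beta>0) / 2\<bar> \<le> i \<beta>0 * (1 + i \<beta>0) / (2 * (1 - i \<beta>0)) \<and>
      (curve_ending_at \<alpha>2 \<Psi> \<beta>0 has_real_derivative (p + q) / (q - p * i \<beta>0)) (at_left \<beta>0)"
    for \<beta>0 p q
  have "\<exists>p q. good \<beta>0 p q" if \<beta>0: "3/4 < \<beta>0" "\<beta>0 < 1" for \<beta>0
  proof -
    define M where "M = (THE M. M \<in> tent_kneadings - {RL_inf} \<and> \<alpha>2 M = \<beta>0)"
    have "M \<in> tent_kneadings - {RL_inf} \<and> \<alpha>2 M = \<beta>0"
      unfolding M_def by (rule theI', rule unique_endpoint) (use \<beta>0 in auto)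
    then have M: "M \<in> tent_kneadings" "M \<in> tent_kneadings - {RL_inf}" "\<alpha>2 M = \<beta>0" by auto
    \<comment> \<open>Any one point of the curve serves to read off its branch pattern.\<close>
    define a0 where "a0 = (\<alpha>1 M + \<beta>0) / 2"
    define r where "r = right_branch a0 (\<Psi> M a0)"
    have knead: "kneading a (\<Psi> M a) = M" and region: "(a, \<Psi> M a) \<in> param_region"
      if "a \<in> {\<alpha>1 M<..<\<beta>0}" for a
      using level_set[OF M(1), of a "\<Psi> M a"] graph_in_region[OF M(1), of a] that M(3) by auto
    have nz: "a \<noteq> 0" if "a \<in> {\<alpha>1 M<..<\<beta>0}" for a
      using region[OF that] by (auto simp: param_region_def)
    have a0: "a0 \<in> {\<alpha>1 M<..<\<beta>0}" using interval[OF M(1)] M(3) by (simp add: a0_def)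
    have pattern: "right_branch a (\<Psi> M a) n = r n" if "a \<in> {\<alpha>1 M<..<\<beta>0}" for a n
      unfolding r_def using knead[OF that] knead[OF a0] nz[OF that] nz[OF a0]
      by (intro right_branch_cong_kneading) auto
    have near: "\<forall>\<^sub>F a in at_left \<beta>0. a \<in> {\<alpha>1 M<..<\<beta>0}"
      using interval[OF M(1)] M(3) by (intro eventually_at_left_real) simp
    have "curve_to_diagonal r (\<Psi> M) \<beta>0"
    proof
      show "\<forall>\<^sub>F a in at_left \<beta>0. (a, \<Psi> M a) \<in> param_region"
        using near by (rule eventually_mono) (rule region)
      show "\<forall>\<^sub>F a in at_left \<beta>0. \<forall>n. right_branch a (\<Psi> M a) n = r n"
        using near by (rule eventually_mono) (simp add: pattern)
      show "(\<Psi> M \<longlongrightarrow> \<beta>0) (at_left \<beta>0)"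
        using reaches_diagonal[OF M(2)] M(3) by simp
    qed (use \<beta>0 in auto)
    from endpoint_derivative_exists[OF this] show ?thesis
      unfolding good_def i_def curve_ending_at_def M_def .
  qed
  then obtain p q where pq: "good \<beta>0 (p \<beta>0) (q \<beta>0)" if "3/4 < \<beta>0" "\<beta>0 < 1" for \<beta>0
    by metis
  have near: "\<forall>\<^sub>F \<beta>0 in at_left 1. \<beta>0 \<in> {3/4<..<1::real}"
    by (rule eventually_at_left_real) simp
  have i: "(i \<longlongrightarrow> 0) (at_left 1)"
    unfolding i_def by (auto intro!: tendsto_eq_intros)
  have "((\<lambda>\<beta>0. p \<beta>0 - (- 1)) \<longlongrightarrow> 0) (at_left 1)"
  proof (rule Lim_null_comparison)
    show "\<forall>\<^sub>F \<beta>0 in at_left 1. norm (p \<beta>0 - (- 1)) \<le> i \<beta>0 / (1 - i \<beta>0)"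
      using near by (rule eventually_mono) (use pq in \<open>simp add: good_def\<close>)
    show "((\<lambda>\<beta>0. i \<beta>0 / (1 - i \<beta>0)) \<longlongrightarrow> 0) (at_left 1)"
      by (auto intro!: tendsto_eq_intros i)
  qed
  then have p: "(p \<longlongrightarrow> - 1) (at_left 1)" by (rule Lim_null[THEN iffD2])
  have "((\<lambda>\<beta>0. q \<beta>0 - (1 - i \<beta>0) / 2) \<longlongrightarrow> 0) (at_left 1)"
  proof (rule Lim_null_comparison)
    show "\<forall>\<^sub>F \<beta>0 in at_left 1. norm (q \<beta>0 - (1 - i \<beta>0) / 2) \<le>
        i \<beta>0 * (1 + i \<beta>0) / (2 * (1 - i \<beta>0))"
      using near by (rule eventually_mono) (use pq in \<open>simp add: good_def\<close>)
    show "((\<lambda>\<beta>0. i \<beta>0 * (1 + i \<beta>0) / (2 * (1 - i \<beta>0))) \<longlongrightarrow> 0) (at_left 1)"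
      by (auto intro!: tendsto_eq_intros i)
  qed
  moreover have "((\<lambda>\<beta>0. (1 - i \<beta>0) / 2) \<longlongrightarrow> 1 / 2) (at_left 1)"
    by (auto intro!: tendsto_eq_intros i)
  ultimately have "((\<lambda>\<beta>0. (q \<beta>0 - (1 - i \<beta>0) / 2) + (1 - i \<beta>0) / 2) \<longlongrightarrow> 0 + 1 / 2) (at_left 1)"
    by (rule tendsto_add)
  then have q: "(q \<longlongrightarrow> 1 / 2) (at_left 1)" by simp
  \<comment> \<open>The denominator tends to \<open>1/2\<close>, so the limit can be taken termwise.\<close>
  let ?D = "\<lambda>\<beta>0. (p \<beta>0 + q \<beta>0) / (q \<beta>0 - p \<beta>0 * i \<beta>0)"
  have "(?D \<longlongrightarrow> (- 1 + 1 / 2) / (1 / 2 - (- 1) * 0)) (at_left 1)"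
    by (intro tendsto_intros p q i) simp
  then have "(?D \<longlongrightarrow> - 1) (at_left 1)" by simp
  moreover have "\<forall>\<^sub>F \<beta>0 in at_left 1.
      (curve_ending_at \<alpha>2 \<Psi> \<beta>0 has_real_derivative ?D \<beta>0) (at_left \<beta>0)"
    using near by (rule eventually_mono) (use pq in \<open>simp add: good_def\<close>)
  ultimately show ?thesis by (intro exI[of _ ?D] conjI)
qed

end
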